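(* Let $p \ge 5$ and $2p \le q \le \binom{p+1}{\lfloor \frac{p+1}{2} \rfloor} - 1$. Then $f(K(3,p,q)) = 2$.
   Context: $K(3,p,q)$ is the complete tripartite graph with parts of sizes $3$, $p$, $q$. A strong orientation of a graph is an orientation of all edges making the digraph strongly connected; the diameter of a strongly connected digraph is the maximum directed distance between ordered pairs of vertices. The oriented diameter $f(G)$ is the minimum diameter over all strong orientations of $G$. *)

theory Defs
  imports "Graph_Theory.Graph_Theory"
begin

text \<open>
  As in Graph_Theory, a finite simple graph is a symmetric digraph (locale \<^locale>\<open>graph\<close>):
  the edge \<open>{u, v}\<close> is the pair of opposite arcs from \<open>u\<close> to \<open>v\<close> and from \<open>v\<close> to \<open>u\<close>.
\<close>

definition complete_tripartite_digraph ::
    "nat \<Rightarrow> nat \<Rightarrow> nat \<Rightarrow> ('a, 'b) pre_digraph \<Rightarrow> bool" where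
  "complete_tripartite_digraph l m n G \<longleftrightarrow> graph G \<and>
    (\<exists>U V W. verts G = U \<union> V \<union> W \<and> U \<inter> V = {} \<and> U \<inter> W = {} \<and> V \<inter> W = {}
      \<and> card U = l \<and> card V = m \<and> card W = n
      \<and> arcs_ends G = (U \<times> V) \<union> (V \<times> U) \<union> (U \<times> W) \<union> (W \<times> U) \<union> (V \<times> W) \<union> (W \<times> V))"

lemma complete_tripartite_digraph_exists:
  "\<exists>G :: (nat \<times> nat, (nat \<times> nat) \<times> (nat \<times> nat)) pre_digraph.
    complete_tripartite_digraph l m n G"
proof -
  define U V W :: "(nat \<times> nat) set"
    where "U = {0} \<times> {..<l}" and "V = {1} \<times> {..<m}" and "W = {2} \<times> {..<n}"
  note UVW = U_def V_def W_def
  define A where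
    "A = (U \<times> V) \<union> (V \<times> U) \<union> (U \<times> W) \<union> (W \<times> U) \<union> (V \<times> W) \<union> (W \<times> V)"
  define G where "G = \<lparr>verts = U \<union> V \<union> W, arcs = A, tail = fst, head = snd\<rparr>"
  have ends: "arcs_ends G = A"
    by (simp add: arcs_ends_conv G_def)
  have "finite A"
    by (simp add: A_def UVW)
  moreover have "sym A"
    unfolding A_def sym_def by blast
  moreover have "fst e \<in> U \<union> V \<union> W \<and> snd e \<in> U \<union> V \<union> W \<and> fst e \<noteq> snd e"
    if "e \<in> A" for e
    using that by (auto simp: A_def UVW)
  ultimately have "graph G"
    using ends
    by unfold_locales (simp_all add: G_def arc_to_ends_def symmetric_def prod_eq_iff UVW)
  moreover have "verts G = U \<union> V \<union> W" "U \<inter> V = {}" "U \<inter> W = {}" "V \<inter> W = {}"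
    "card U = l" "card V = m" "card W = n"
    by (auto simp: G_def UVW card_cartesian_product)
  ultimately show ?thesis
    unfolding complete_tripartite_digraph_def
    by (intro exI[of _ G] conjI exI[of _ U] exI[of _ V] exI[of _ W]) (simp_all add: ends A_def)
qed

text \<open>An orientation keeps all vertices and exactly one of the two arcs of every edge.\<close>

definition orientation :: "('a, 'b) pre_digraph \<Rightarrow> ('a, 'b) pre_digraph \<Rightarrow> bool" where
  "orientation D G \<longleftrightarrow> spanning D G \<and>
    (\<forall>u v. u \<rightarrow>\<^bsub>G\<^esub> v \<longrightarrow> (u \<rightarrow>\<^bsub>D\<^esub> v) \<noteq> (v \<rightarrow>\<^bsub>D\<^esub> u))"

definition strong_orientation :: "('a, 'b) pre_digraph \<Rightarrow> ('a, 'b) pre_digraph \<Rightarrow> bool" where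
  "strong_orientation D G \<longleftrightarrow> orientation D G \<and> strongly_connected D"

text \<open>
  With unit arc costs, \<open>\<mu>\<close> is the least number of arcs of a walk. The constant
  \<open>wf_digraph.\<mu>\<close> is only meaningful for a \<^const>\<open>wf_digraph\<close>, which every
  orientation is (by \<^const>\<open>spanning\<close>).
\<close>

definition ddist :: "('a, 'b) pre_digraph \<Rightarrow> 'a \<Rightarrow> 'a \<Rightarrow> ereal" where
  "ddist D u v = wf_digraph.\<mu> D (\<lambda>_. 1) u v"

text \<open>For a finite nonempty digraph the supremum is a maximum.\<close>

definition ddiameter :: "('a, 'b) pre_digraph \<Rightarrow> ereal" where
  "ddiameter D = (SUP (u, v) \<in> verts D \<times> verts D. ddist D u v)"

text \<open>
  A finite graph has finitely many orientations, so the infimum is a minimum if a strong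
  orientation exists; otherwise it is \<open>\<infinity>\<close>.
\<close>

definition oriented_diameter :: "('a, 'b) pre_digraph \<Rightarrow> ereal" where
  "oriented_diameter G = (INF D \<in> {D. strong_orientation D G}. ddiameter D)"

end

theory Submission
  imports Defs
begin

text \<open>
  Write \<open>U = {x\<^sub>1, x\<^sub>2, x\<^sub>3}\<close>, let \<open>k = \<lfloor>(p + 1) / 2\<rfloor>\<close> and add a new element \<open>b\<close> to the part \<open>V\<close>
  of size \<open>p\<close>. Label the vertices of the part \<open>W\<close> of size \<open>q\<close> by distinct \<open>k\<close>-subsets of
  \<open>V \<union> {b}\<close>, all different from one fixed \<open>k\<close>-subset \<open>P\<close> of \<open>V\<close>. Orient \<open>V \<rightarrow> x\<^sub>1 \<rightarrow> W \<rightarrow> x\<^sub>3 \<rightarrow> V\<close>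
  and \<open>V - P \<rightarrow> x\<^sub>2 \<rightarrow> P\<close>, and let \<open>w\<close> labelled \<open>S\<close> dominate exactly the elements of \<open>S\<close> in \<open>V\<close>,
  and \<open>x\<^sub>2\<close> if and only if \<open>b \<in> S\<close>. Two labels never contain one another, and none is comparable with
  \<open>P\<close>; this gives the paths of length two between vertices of \<open>W\<close>, and between \<open>x\<^sub>2\<close> and \<open>W\<close>.
  The remaining pairs only need that the labels separate the points of \<open>V \<union> {b}\<close>, which
  the \<open>p + 1\<close> cyclic intervals of length \<open>k\<close> already do; \<open>P\<close> exists because
  \<open>q\<close> is less than the number of \<open>k\<close>-subsets.
\<close>

section \<open>Orientations of diameter two\<close>

lemma ddiameter_le_2:
  fixes D :: "('a, 'b) pre_digraph"
  assumes "wf_digraph D"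
    and step: "\<And>u v. u \<in> verts D \<Longrightarrow> v \<in> verts D \<Longrightarrow> u \<noteq> v \<Longrightarrow>
      u \<rightarrow>\<^bsub>D\<^esub> v \<or> (\<exists>w. u \<rightarrow>\<^bsub>D\<^esub> w \<and> w \<rightarrow>\<^bsub>D\<^esub> v)"
  shows "ddiameter D \<le> 2"
proof -
  interpret wf_digraph D by fact
  have "ddist D u v \<le> 2" if uv: "u \<in> verts D" "v \<in> verts D" for u v
  proof -
    have "\<exists>es. awalk u es v \<and> length es \<le> 2"
    proof (cases "u = v")
      case True
      then have "awalk u [] v"
        using uv by (simp add: awalk_def)
      then show ?thesis by (intro exI[of _ "[]"]) simp
    next
      case False
      from step[OF uv this] show ?thesis
      proof (elim disjE exE conjE)
        assume "u \<rightarrow>\<^bsub>D\<^esub> v"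
        then obtain e where "e \<in> arcs D" "tail D e = u" "head D e = v" by blast
        then have "awalk u [e] v"
          using uv by (simp add: awalk_def)
        then show ?thesis by (intro exI[of _ "[e]"]) simp
      next
        fix w assume "u \<rightarrow>\<^bsub>D\<^esub> w" "w \<rightarrow>\<^bsub>D\<^esub> v"
        then obtain e e' where "e \<in> arcs D" "tail D e = u" "head D e = w"
          "e' \<in> arcs D" "tail D e' = w" "head D e' = v" by (elim reachableE)
        then have "awalk u [e, e'] v"
          using uv by (simp add: awalk_def)
        then show ?thesis by (intro exI[of _ "[e, e']"]) simp
      qed
    qed
    then obtain es where es: "awalk u es v" "length es \<le> 2" by blast
    then have "ddist D u v \<le> ereal (awalk_cost (\<lambda>_. 1) es)"
      unfolding ddist_def by (intro min_cost_le_walk_cost)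
    also have "\<dots> \<le> 2"
      using es(2) by (simp add: awalk_cost_def sum_list_triv)
    finally show ?thesis .
  qed
  then show ?thesis
    unfolding ddiameter_def by (auto intro!: SUP_least)
qed

text \<open>Only one of the two arcs of an edge survives in \<open>D\<close>, so one end of the edge
  is not dominated by the other, and every walk in that direction has at least two arcs.\<close>

lemma ddiameter_ge_2:
  fixes G D :: "('a, 'b) pre_digraph"
  assumes "graph G" and ori: "orientation D G" and "u \<rightarrow>\<^bsub>G\<^esub> v"
  shows "2 \<le> ddiameter D"
proof -
  interpret graph G by fact
  have sub: "subgraph D G" and verts_eq: "verts G = verts D"
    using ori by (auto simp: orientation_def spanning_def)
  interpret D: wf_digraph D
    using sub by (simp add: subgraph_def)
  have "(u \<rightarrow>\<^bsub>D\<^esub> v) \<noteq> (v \<rightarrow>\<^bsub>D\<^esub> u)"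
    using ori \<open>u \<rightarrow>\<^bsub>G\<^esub> v\<close> by (auto simp: orientation_def)
  moreover have "u \<noteq> v"
    using \<open>u \<rightarrow>\<^bsub>G\<^esub> v\<close> adj_not_same by blast
  moreover have "u \<in> verts D" "v \<in> verts D"
    using \<open>u \<rightarrow>\<^bsub>G\<^esub> v\<close> adj_in_verts verts_eq by auto
  ultimately obtain s t where st: "s \<noteq> t" "s \<in> verts D" "t \<in> verts D" "\<not> s \<rightarrow>\<^bsub>D\<^esub> t"
    by metis
  have len: "2 \<le> length es" if "D.awalk s es t" for es
  proof (rule ccontr)
    assume "\<not> 2 \<le> length es"
    then consider "es = []" | e where "es = [e]"
      by (cases es; cases "tl es") auto
    then show False
    proof cases
      case 1
      then show False using that st by (simp add: D.awalk_def)
    next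
      case 2
      then have "s \<rightarrow>\<^bsub>D\<^esub> t"
        using that by (intro D.dominatesI[of e]) (auto simp: D.awalk_def arc_to_ends_def)
      then show False using st by simp
    qed
  qed
  have "2 \<le> ddist D s t"
    unfolding ddist_def D.\<mu>_def
    by (rule INF_greatest) (use len in \<open>auto simp: awalk_cost_def sum_list_triv\<close>)
  also have "\<dots> \<le> ddiameter D"
    unfolding ddiameter_def using st by (intro SUP_upper2[of "(s, t)"]) auto
  finally show ?thesis .
qed

text \<open>Reduces the construction to a relation \<open>R\<close> on vertices: keeping the arcs of
  \<open>G\<close> with ends in \<open>R\<close> gives an orientation, and paths of length at most
  two give both strong connectivity and the diameter bound.\<close>

lemma strong_orientation_of_relation:
  fixes G :: "('a, 'b) pre_digraph" and R :: "('a \<times> 'a) set"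
  assumes "graph G" and "verts G \<noteq> {}"
    and arc: "R \<subseteq> arcs_ends G"
    and choice: "\<And>u v. (u, v) \<in> arcs_ends G \<Longrightarrow> ((u, v) \<in> R) \<noteq> ((v, u) \<in> R)"
    and step: "\<And>u v. u \<in> verts G \<Longrightarrow> v \<in> verts G \<Longrightarrow> u \<noteq> v \<Longrightarrow>
      (u, v) \<in> R \<or> (\<exists>w. (u, w) \<in> R \<and> (w, v) \<in> R)"
  shows "\<exists>D. strong_orientation D G \<and> ddiameter D \<le> 2"
proof -
  interpret graph G by fact
  define D where "D = G\<lparr>arcs := {e \<in> arcs G. (tail G e, head G e) \<in> R}\<rparr>"
  have verts_D: "verts D = verts G"
    by (simp add: D_def)
  have "arcs_ends D = {(tail G e, head G e) | e. e \<in> arcs G \<and> (tail G e, head G e) \<in> R}"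
    by (auto simp: arcs_ends_conv D_def)
  also have "\<dots> = R"
    using arc by (auto simp: arcs_ends_conv)
  finally have ends_D: "arcs_ends D = R" .
  have wf_D: "wf_digraph D"
    by unfold_locales (auto simp: D_def)
  interpret D: wf_digraph D by (fact wf_D)
  have "spanning D G"
    unfolding spanning_def subgraph_def compatible_def
    using wf_D wf_digraph by (auto simp: D_def)
  then have "orientation D G"
    using choice by (auto simp: orientation_def ends_D)
  moreover have "u \<rightarrow>\<^sup>*\<^bsub>D\<^esub> v" if "u \<in> verts D" "v \<in> verts D" for u v
    using step[of u v] that by (metis D.adj_reachable_trans D.reachable_adjI D.reachable_refl ends_D verts_D)
  then have "strongly_connected D"
    using \<open>verts G \<noteq> {}\<close> by (auto simp: strongly_connected_def verts_D)
  moreover have "ddiameter D \<le> 2"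
    using step by (intro ddiameter_le_2 wf_D) (auto simp: ends_D verts_D)
  ultimately show ?thesis
    by (auto simp: strong_orientation_def)
qed

section \<open>Separating families\<close>

text \<open>The image is the interval of \<open>k\<close> consecutive points starting at
  \<open>i\<close> on a cycle of length \<open>n\<close>; the \<open>if\<close> is reduction modulo
  \<open>n\<close>. Either the interval just after \<open>x\<close> or the one just before
  \<open>x\<close> reaches \<open>y\<close>.\<close>

lemma cyclic_intervals_separate:
  fixes n k x y :: nat
  assumes "k < n" "n \<le> 2 * k + 1" "x < n" "y < n" "x \<noteq> y"
  shows "\<exists>i<n. x \<notin> (\<lambda>j. if i + j < n then i + j else i + j - n) ` {..<k} \<and>
    y \<in> (\<lambda>j. if i + j < n then i + j else i + j - n) ` {..<k}"
proof -
  \<comment> \<open>The cyclic distance from \<open>x\<close> forward to \<open>y\<close>.\<close>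
  define d where "d = (if x < y then y - x else y + n - x)"
  show ?thesis
  proof (cases "d \<le> k")
    case True
    \<comment> \<open>Start just after \<open>x\<close>: \<open>y\<close> has offset
      \<open>d - 1\<close>, and \<open>k < n\<close> stops the interval before it returns to
      \<open>x\<close>.\<close>
    define i where "i = (if x + 1 < n then x + 1 else 0)"
    have "i < n" using assms by (auto simp: i_def)
    moreover have "x \<notin> (\<lambda>j. if i + j < n then i + j else i + j - n) ` {..<k}"
      using assms by (auto simp: i_def split: if_splits)
    moreover have "y = (if i + (d - 1) < n then i + (d - 1) else i + (d - 1) - n)" "d - 1 < k"
      using assms True by (auto simp: i_def d_def split: if_splits)
    ultimately show ?thesis by blast
  next
    case False
    \<comment> \<open>End just before \<open>x\<close>: from \<open>y\<close> to \<open>x\<close>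
      there are \<open>n - d\<close> steps, at most \<open>k\<close> because \<open>d > k\<close>
      and \<open>n \<le> 2 * k + 1\<close>.\<close>
    define i where "i = (if k \<le> x then x - k else x + n - k)"
    define j where "j = k - (n - d)"
    have "i < n" using assms by (auto simp: i_def)
    moreover have "x \<notin> (\<lambda>j. if i + j < n then i + j else i + j - n) ` {..<k}"
      using assms by (auto simp: i_def split: if_splits)
    moreover have "y = (if i + j < n then i + j else i + j - n)" "j < k"
      using assms False by (auto simp: i_def d_def j_def split: if_splits)
    ultimately show ?thesis by blast
  qed
qed

text \<open>Any family containing the \<open>n\<close> cyclic intervals still separates points, so
  they are padded with further \<open>k\<close>-subsets to size \<open>q\<close>.\<close>

lemma separating_family:
  fixes n k q :: nat
  assumes "k < n" "n \<le> 2 * k + 1" "n \<le> q" "q < n choose k"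
  obtains F P where "F \<subseteq> {S. S \<subseteq> {..<n} \<and> card S = k}" "card F = q"
    "P \<subseteq> {..<n}" "card P = k" "P \<notin> F"
    "\<And>x y. x < n \<Longrightarrow> y < n \<Longrightarrow> x \<noteq> y \<Longrightarrow> \<exists>S\<in>F. x \<notin> S \<and> y \<in> S"
proof -
  define K where "K = {S. S \<subseteq> {..<n} \<and> card S = k}"
  have card_K: "card K = n choose k"
    unfolding K_def using n_subsets[of "{..<n}" k] by simp
  have fin_K: "finite K"
    by (rule finite_subset[of _ "Pow {..<n}"]) (auto simp: K_def)
  define I where "I i = (\<lambda>j. if i + j < n then i + j else i + j - n) ` {..<k}" for i
  have "card (I i) = k" for i
    unfolding I_def using \<open>k < n\<close>
    by (subst card_image) (auto simp: inj_on_def split: if_splits)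
  moreover have "I i \<subseteq> {..<n}" if "i < n" for i
    using that \<open>k < n\<close> by (auto simp: I_def)
  ultimately have "I ` {..<n} \<subseteq> K"
    by (auto simp: K_def)
  moreover have "card (I ` {..<n}) \<le> q"
    using card_image_le[of "{..<n}" I] \<open>n \<le> q\<close> by simp
  ultimately obtain F where F: "I ` {..<n} \<subseteq> F" "F \<subseteq> K" "card F = q"
    using exists_subset_between[of "I ` {..<n}" q K] card_K assms(4) fin_K by auto
  have "F \<noteq> K" using F card_K assms(4) by auto
  then obtain P where "P \<in> K" "P \<notin> F" using F by blast
  moreover have "\<exists>S\<in>F. x \<notin> S \<and> y \<in> S" if xy: "x < n" "y < n" "x \<noteq> y" for x y
  proof -
    obtain i where "i < n" "x \<notin> I i" "y \<in> I i"
      using cyclic_intervals_separate[OF assms(1,2) xy] unfolding I_def by blast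
    then show ?thesis using F(1) by blast
  qed
  ultimately show ?thesis
    using F that[of F P] by (auto simp: K_def)
qed

section \<open>The orientation\<close>

text \<open>
  Here \<open>B w\<close> is the set of out-neighbours of \<open>w\<close> in \<open>V\<close>, and \<open>T\<close> is the set of in-neighbours
  of \<open>x\<^sub>2\<close> in \<open>W\<close>.
\<close>

lemma tripartite_orientation:
  fixes G :: "('a, 'b) pre_digraph" and B :: "'a \<Rightarrow> 'a set"
  assumes "graph G"
    and verts: "verts G = {x1, x2, x3} \<union> V \<union> W"
    and neq: "x1 \<noteq> x2" "x2 \<noteq> x3" "x1 \<noteq> x3"
    and disj: "{x1, x2, x3} \<inter> V = {}" "{x1, x2, x3} \<inter> W = {}" "V \<inter> W = {}"
    and ends: "arcs_ends G = ({x1, x2, x3} \<times> V) \<union> (V \<times> {x1, x2, x3})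
      \<union> ({x1, x2, x3} \<times> W) \<union> (W \<times> {x1, x2, x3}) \<union> (V \<times> W) \<union> (W \<times> V)"
    and sub: "P \<subseteq> V" "T \<subseteq> W" "\<And>w. w \<in> W \<Longrightarrow> B w \<subseteq> V"
    and P: "P \<noteq> {}" "P \<noteq> V"
    and B: "\<And>w. w \<in> W \<Longrightarrow> B w \<noteq> {}" "\<And>w. w \<in> W \<Longrightarrow> B w \<noteq> V"
    and T: "\<And>w. w \<in> T \<Longrightarrow> \<not> P \<subseteq> B w" "\<And>w. w \<in> W \<Longrightarrow> w \<notin> T \<Longrightarrow> \<not> B w \<subseteq> P"
    and anti: "\<And>w w'. w \<in> W \<Longrightarrow> w' \<in> W \<Longrightarrow> w \<noteq> w' \<Longrightarrow> \<not> B w \<subseteq> B w' \<or> (w \<in> T \<and> w' \<notin> T)"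
    and sep: "\<And>v v'. v \<in> V \<Longrightarrow> v' \<in> V \<Longrightarrow> v \<noteq> v' \<Longrightarrow> \<exists>w\<in>W. v \<notin> B w \<and> v' \<in> B w"
      "\<And>v. v \<in> V \<Longrightarrow> \<exists>w\<in>T. v \<notin> B w" "\<And>v. v \<in> V \<Longrightarrow> \<exists>w\<in>W. w \<notin> T \<and> v \<in> B w"
  shows "\<exists>D. strong_orientation D G \<and> ddiameter D \<le> 2"
proof -
  define R where "R = (V \<times> {x1}) \<union> ({x2} \<times> P) \<union> ((V - P) \<times> {x2}) \<union> ({x3} \<times> V)
    \<union> ({x1} \<times> W) \<union> (T \<times> {x2}) \<union> ({x2} \<times> (W - T)) \<union> (W \<times> {x3})
    \<union> {(w, v). w \<in> W \<and> v \<in> B w} \<union> {(v, w). v \<in> V \<and> w \<in> W \<and> v \<notin> B w}"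
  have arc: "(v, x1) \<in> R" "(x3, v) \<in> R" "v \<in> P \<Longrightarrow> (x2, v) \<in> R" "v \<notin> P \<Longrightarrow> (v, x2) \<in> R"
    if "v \<in> V" for v
    using that by (auto simp: R_def)
  have arcW: "(x1, w) \<in> R" "(w, x3) \<in> R" "w \<in> T \<Longrightarrow> (w, x2) \<in> R" "w \<notin> T \<Longrightarrow> (x2, w) \<in> R"
    "v \<in> B w \<Longrightarrow> (w, v) \<in> R" "v \<in> V \<Longrightarrow> v \<notin> B w \<Longrightarrow> (v, w) \<in> R"
    if "w \<in> W" for v w
    using that by (auto simp: R_def)
  \<comment> \<open>These serve as midpoints between the three vertices: \<open>w0\<close> for
    \<open>x1\<close> to \<open>x2\<close>, \<open>w1\<close> for \<open>x2\<close> to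
    \<open>x3\<close>, \<open>v0\<close> for \<open>x2\<close> to \<open>x1\<close>, and
    \<open>v1\<close> for \<open>x3\<close> to \<open>x2\<close>.\<close>
  obtain v0 v1 where v01: "v0 \<in> P" "v1 \<in> V" "v1 \<notin> P" using P sub(1) by blast
  obtain w0 w1 where w01: "w0 \<in> T" "w1 \<in> W" "w1 \<notin> T" "w0 \<in> W"
    using sep(2,3)[OF v01(2)] sub by blast
  define near where "near u v \<longleftrightarrow> (u, v) \<in> R \<or> (\<exists>w. (u, w) \<in> R \<and> (w, v) \<in> R)" for u v
  have one: "near u v" if "(u, v) \<in> R" for u v
    using that by (simp add: near_def)
  have two: "near u v" if "(u, w) \<in> R" "(w, v) \<in> R" for u v w
    using that by (auto simp: near_def)
  have UU: "near u v" if "u \<in> {x1, x2, x3}" "v \<in> {x1, x2, x3}" "u \<noteq> v" for u v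
  proof -
    have "near x1 x2" "near x2 x3"
      using two arcW[OF w01(4)] arcW[OF w01(2)] w01(1,3) by metis+
    moreover have "near x1 x3"
      using two arcW(1,2)[OF w01(4)] by metis
    moreover have "near x2 x1" "near x3 x1" "near x3 x2"
      using two arc[OF v01(2)] arc[of v0] v01 sub(1) by blast+
    ultimately show ?thesis using that by blast
  qed
  have VV: "near u v" if uv: "u \<in> V" "v \<in> V" "u \<noteq> v" for u v
  proof -
    obtain w where "w \<in> W" "u \<notin> B w" "v \<in> B w" using sep(1)[OF uv] by blast
    then show ?thesis using two[of u w v] arcW(5,6) uv by blast
  qed
  have WW: "near w w'" if ww: "w \<in> W" "w' \<in> W" "w \<noteq> w'" for w w'
    using anti[OF ww]
  proof
    assume "\<not> B w \<subseteq> B w'"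
    then obtain v where "v \<in> B w" "v \<in> V" "v \<notin> B w'" using sub(3) ww by blast
    then show ?thesis using two[of w v w'] arcW(5)[OF ww(1)] arcW(6)[OF ww(2)] by blast
  next
    assume "w \<in> T \<and> w' \<notin> T"
    then show ?thesis using two[of w x2 w'] arcW(3)[OF ww(1)] arcW(4)[OF ww(2)] by blast
  qed
  have UV: "near u v \<and> near v u" if "u \<in> {x1, x2, x3}" and v: "v \<in> V" for u v
  proof -
    \<comment> \<open>\<open>w\<close> carries the paths from \<open>v\<close> to \<open>x2\<close>
      and \<open>x3\<close>, and \<open>w'\<close> those from \<open>x1\<close> and
      \<open>x2\<close> to \<open>v\<close>; the other two pairs are arcs.\<close>
    obtain w w' where w: "w \<in> T" "w \<in> W" "v \<notin> B w" "w' \<in> W" "w' \<notin> T" "v \<in> B w'"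
      using sep(2,3)[OF v] sub(2) by blast
    note out = arcW(6)[OF w(2) v w(3)] and inn = arcW(5)[OF w(4) w(6)]
    have "near x1 v" "near x2 v" "near x3 v"
      using two[OF _ inn] one[OF arc(2)[OF v]] arcW(1,4)[OF w(4)] w(5) by blast+
    moreover have "near v x1" "near v x2" "near v x3"
      using two[OF out] one[OF arc(1)[OF v]] arcW(2,3)[OF w(2)] w(1) by blast+
    ultimately show ?thesis using that(1) by blast
  qed
  have UW: "near u w \<and> near w u" if "u \<in> {x1, x2, x3}" and w: "w \<in> W" for u w
  proof -
    obtain v v' where v: "v \<in> V" "v \<in> B w" "v' \<in> V" "v' \<notin> B w"
      using B sub(3) w by blast
    have "near x1 w" "near w x3"
      using one arcW(1,2)[OF w] by blast+
    moreover have "near w x1" "near x3 w"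
      using two[OF arcW(5)[OF w v(2)] arc(1)[OF v(1)]] two[OF arc(2)[OF v(3)] arcW(6)[OF w v(3,4)]]
      by auto
    moreover have "near x2 w \<and> near w x2"
    \<comment> \<open>One direction is an arc. The other passes through \<open>P - B w\<close> if
      \<open>w \<in> T\<close>, and through \<open>B w - P\<close> otherwise.\<close>
    proof (cases "w \<in> T")
      case True
      then obtain v where v: "v \<in> P" "v \<in> V" "v \<notin> B w" using T(1) sub(1) by blast
      show ?thesis
        using one[OF arcW(3)[OF w True]] two[OF arc(3)[OF v(2,1)] arcW(6)[OF w v(2,3)]] by simp
    next
      case False
      then obtain v where v: "v \<in> B w" "v \<in> V" "v \<notin> P" using T(2) sub(3) w by blast
      show ?thesis
        using one[OF arcW(4)[OF w False]] two[OF arcW(5)[OF w v(1)] arc(4)[OF v(2,3)]] by simp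
    qed
    ultimately show ?thesis using that(1) by blast
  qed
  \<comment> \<open>Whichever way the edge points, the routes through \<open>x1\<close> and
    \<open>x3\<close> supply both directions.\<close>
  have VW: "near v w \<and> near w v" if v: "v \<in> V" and w: "w \<in> W" for v w
    using one[OF arcW(5)[OF w]] one[OF arcW(6)[OF w v]]
      two[OF arc(1)[OF v] arcW(1)[OF w]] two[OF arcW(2)[OF w] arc(2)[OF v]] by blast
  have near: "near u v" if "u \<in> verts G" "v \<in> verts G" "u \<noteq> v" for u v
    using that UU[of u v] VV[of u v] WW[of u v] UV[of u v] UV[of v u] UW[of u v] UW[of v u]
      VW[of u v] VW[of v u] unfolding verts by blast
  have R_sub: "R \<subseteq> arcs_ends G"
    unfolding ends R_def using sub by blast
  have choice: "((u, v) \<in> R) \<noteq> ((v, u) \<in> R)" if uv: "(u, v) \<in> arcs_ends G" for u v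
  proof -
    have UV: "((u, v) \<in> R) \<noteq> ((v, u) \<in> R)" if "u \<in> {x1, x2, x3}" "v \<in> V" for u v
      using that neq disj sub(1,2) sub(3)[of v] by (auto simp: R_def)
    have UW: "((u, v) \<in> R) \<noteq> ((v, u) \<in> R)" if "u \<in> {x1, x2, x3}" "v \<in> W" for u v
      using that neq disj sub(1,2) sub(3)[of v] by (auto simp: R_def)
    have VW: "((u, v) \<in> R) \<noteq> ((v, u) \<in> R)" if "u \<in> V" "v \<in> W" for u v
      using that neq disj sub(1,2) sub(3)[of v] sub(3)[of u] by (auto simp: R_def)
    show ?thesis
      using uv UV[of u v] UV[of v u] UW[of u v] UW[of v u] VW[of u v] VW[of v u]
      unfolding ends by blast
  qed
  show ?thesis
    using verts by (intro strong_orientation_of_relation[OF \<open>graph G\<close> _ R_sub choice near[unfolded near_def]]) auto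
qed

section \<open>Labelling by \<open>k\<close>-subsets\<close>

text \<open>The numbers below \<open>p + 1\<close> model \<open>V\<close> with the extra point
  \<open>b\<close>: \<open>f\<close> identifies \<open>V\<close> with the numbers other than
  \<open>b\<close>, and \<open>g\<close> gives the labels. The bound on \<open>p\<close> yields
  \<open>2 \<le> k < p\<close>; the lower bound on \<open>q\<close> makes room for the cyclic
  intervals.\<close>

lemma complete_tripartite_orientation:
  fixes p q :: nat and G :: "('a, 'b) pre_digraph"
  assumes p: "p \<ge> 3" and q: "p + 1 \<le> q" "q < (p + 1) choose ((p + 1) div 2)"
    and G: "complete_tripartite_digraph 3 p q G"
  shows "\<exists>D. strong_orientation D G \<and> ddiameter D \<le> 2"
proof -
  obtain U V W where UVW: "verts G = U \<union> V \<union> W" "U \<inter> V = {}" "U \<inter> W = {}" "V \<inter> W = {}"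
    "card U = 3" "card V = p" "card W = q"
    "arcs_ends G = (U \<times> V) \<union> (V \<times> U) \<union> (U \<times> W) \<union> (W \<times> U) \<union> (V \<times> W) \<union> (W \<times> V)"
    and "graph G"
    using G unfolding complete_tripartite_digraph_def by auto
  obtain x1 x2 x3 where U: "U = {x1, x2, x3}" "x1 \<noteq> x2" "x2 \<noteq> x3" "x1 \<noteq> x3"
    using UVW(5) by (auto simp: card_3_iff)
  define k where "k = (p + 1) div 2"
  have k: "2 \<le> k" "k < p" "k < p + 1" "p + 1 \<le> 2 * k + 1"
    using p unfolding k_def by auto
  obtain F P where F: "F \<subseteq> {S. S \<subseteq> {..<p + 1} \<and> card S = k}" "card F = q"
    and P: "P \<subseteq> {..<p + 1}" "card P = k" "P \<notin> F"
    and sep: "\<And>x y. x < p + 1 \<Longrightarrow> y < p + 1 \<Longrightarrow> x \<noteq> y \<Longrightarrow> \<exists>S\<in>F. x \<notin> S \<and> y \<in> S"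
    by (rule separating_family[OF k(3,4) q(1) q(2)[folded k_def]]) (rule that)
  have FS: "S \<subseteq> {..<p + 1}" "card S = k" "finite S" if "S \<in> F" for S
    using F(1) that finite_subset[of S "{..<p + 1}"] by auto
  have fin_P: "finite P"
    using P(1) finite_subset by blast
  have not_sub: "\<not> S \<subseteq> S'" if "card S = k" "card S' = k" "finite S'" "S \<noteq> S'" for S S' :: "nat set"
    using that card_subset_eq by metis
  have "P \<noteq> {..<p + 1}" using P(2) k by auto
  \<comment> \<open>Choosing \<open>b\<close> after \<open>P\<close>, and outside it, makes
    \<open>P\<close> correspond to a \<open>k\<close>-subset of \<open>V\<close>.\<close>
  then obtain b where b: "b < p + 1" "b \<notin> P" using P(1) by blast
  define X where "X = {..<p + 1} - {b}"
  have X: "card X = p" "finite X" using b by (auto simp: X_def)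
  have "finite V" "finite W" "finite F"
    using UVW F(2) p q by (auto intro: card_ge_0_finite)
  then obtain f g where f: "bij_betw f V X" and g: "bij_betw g W F"
    using finite_same_card_bij[of V X] finite_same_card_bij[of W F] UVW F X by metis
  have fV: "f v < p + 1" "f v \<noteq> b" if "v \<in> V" for v
    using bij_betwE[OF f] that by (auto simp: X_def)
  have fX: "\<exists>v\<in>V. f v = x" if "x < p + 1" "x \<noteq> b" for x
  proof -
    have "x \<in> f ` V" using that by (simp add: bij_betw_imp_surj_on[OF f] X_def)
    then show ?thesis by blast
  qed
  have f_inj: "f v \<noteq> f v'" if "v \<in> V" "v' \<in> V" "v \<noteq> v'" for v v'
    using f that by (auto simp: bij_betw_def inj_on_def)
  have gW: "g w \<in> F" if "w \<in> W" for w
    using bij_betwE[OF g] that by auto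
  have gF: "\<exists>w\<in>W. g w = S" if "S \<in> F" for S
    using that bij_betw_imp_surj_on[OF g] by blast
  have g_inj: "g w \<noteq> g w'" if "w \<in> W" "w' \<in> W" "w \<noteq> w'" for w w'
    using g that by (auto simp: bij_betw_def inj_on_def)
  define P' T B where "P' = {v \<in> V. f v \<in> P}" and "T = {w \<in> W. b \<in> g w}"
    and "B w = {v \<in> V. f v \<in> g w}" for w
  note [simp] = P'_def T_def B_def
  \<comment> \<open>\<open>V\<close> sees sets only away from \<open>b\<close>, so a non-inclusion
    has a witness in \<open>V\<close> once it survives adding \<open>b\<close> on the right.\<close>
  have in_X: "\<exists>v\<in>V. f v \<in> S - S'" if "S \<subseteq> {..<p + 1}" "\<not> S \<subseteq> insert b S'" for S S'
  proof -
    from that(2) obtain x where "x \<in> S" "x \<notin> S'" "x \<noteq> b" by auto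
    then show ?thesis using fX[of x] that(1) by auto
  qed
  have big: "\<not> S \<subseteq> insert b {}" if "card S = k" for S
    using card_mono[of "{b}" S] that k by auto
  have small: "\<not> {..<p + 1} \<subseteq> insert b S" if "card S = k" "finite S" for S
    using card_mono[of "insert b S" "{..<p + 1}"] card_insert_le_m1[of "k + 1" S b] that k by auto
  show ?thesis
  proof (rule tripartite_orientation[where P = P' and T = T and B = B])
    show "P' \<noteq> {}" using in_X[OF P(1) big[OF P(2)]] by auto
    show "P' \<noteq> V" using in_X[OF order_refl small[OF P(2) fin_P]] by auto
    show "B w \<noteq> {}" if "w \<in> W" for w
      using in_X[OF FS(1) big[OF FS(2)], OF gW gW, OF that that] by auto
    show "B w \<noteq> V" if "w \<in> W" for w
      using in_X[OF order_refl small[OF FS(2,3)], OF gW gW, OF that that] by auto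
    show "\<not> P' \<subseteq> B w" if "w \<in> T" for w
    proof -
      have w: "g w \<in> F" "b \<in> g w" using that gW by auto
      \<comment> \<open>Adding \<open>b\<close> changes nothing as \<open>b \<in> g w\<close>, and
        distinct sets of the same size \<open>k\<close> are incomparable.\<close>
      then have "\<not> P \<subseteq> insert b (g w)"
        using not_sub[OF P(2) FS(2,3)] P(3) by (metis insert_absorb)
      then show ?thesis using in_X[OF P(1)] by auto
    qed
    show "\<not> B w \<subseteq> P'" if "w \<in> W" "w \<notin> T" for w
    proof -
      have w: "g w \<in> F" "b \<notin> g w" using that gW by auto
      then have "\<not> g w \<subseteq> insert b P"
        using not_sub[OF FS(2) P(2) fin_P] P(3) by (metis subset_insert)
      then show ?thesis using in_X[OF FS(1)[OF w(1)]] by auto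
    qed
    show "\<not> B w \<subseteq> B w' \<or> (w \<in> T \<and> w' \<notin> T)" if "w \<in> W" "w' \<in> W" "w \<noteq> w'" for w w'
    proof -
      have w: "g w \<in> F" "g w' \<in> F" "g w \<noteq> g w'" using that gW g_inj by auto
      then have "\<not> g w \<subseteq> g w'"
        using not_sub FS by metis
      then obtain x where x: "x \<in> g w" "x \<notin> g w'" by blast
      show ?thesis
      \<comment> \<open>If \<open>b\<close> is the separating element, it is visible only through
        \<open>T\<close>, which is the second alternative.\<close>
      proof (cases "x = b")
        case True
        then show ?thesis using x that by simp
      next
        case False
        then show ?thesis using fX[of x] x FS(1)[OF w(1)] by auto
      qed
    qed
    show "\<exists>w\<in>W. v \<notin> B w \<and> v' \<in> B w" if v: "v \<in> V" "v' \<in> V" "v \<noteq> v'" for v v'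
    proof -
      obtain S where "S \<in> F" "f v \<notin> S" "f v' \<in> S"
        using sep[of "f v" "f v'"] fV(1) f_inj v by blast
      then show ?thesis using gF[of S] v by auto
    qed
    show "\<exists>w\<in>T. v \<notin> B w" if v: "v \<in> V" for v
    proof -
      \<comment> \<open>Since membership in \<open>T\<close> means \<open>b\<close> is in the label,
        separating \<open>f v\<close> from \<open>b\<close> is what is required.\<close>
      obtain S where "S \<in> F" "f v \<notin> S" "b \<in> S"
        using sep[of "f v" b] fV[OF v] b(1) by blast
      then show ?thesis using gF[of S] by auto
    qed
    show "\<exists>w\<in>W. w \<notin> T \<and> v \<in> B w" if v: "v \<in> V" for v
    proof -
      obtain S where "S \<in> F" "b \<notin> S" "f v \<in> S"
        using sep[of b "f v"] fV[OF v] b(1) by metis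
      then show ?thesis using gF[of S] v by auto
    qed
  qed (use UVW U \<open>graph G\<close> in auto)
qed

theorem theorem5p4:
  fixes p q :: nat and G :: "('a, 'b) pre_digraph"
  assumes "p \<ge> 5"
    and "2 * p \<le> q"
    and "q \<le> ((p + 1) choose ((p + 1) div 2)) - 1"
    and "complete_tripartite_digraph 3 p q G"
  shows "oriented_diameter G = 2"
proof (rule antisym)
  \<comment> \<open>Subtraction on \<open>nat\<close> is truncated; the bound is strict because the
    lower bounds make \<open>q\<close> positive.\<close>
  have "q < (p + 1) choose ((p + 1) div 2)"
    using assms(1-3) by linarith
  then obtain D where "strong_orientation D G" "ddiameter D \<le> 2"
    using complete_tripartite_orientation[of p q G] assms by auto
  then show "oriented_diameter G \<le> 2"
    unfolding oriented_diameter_def by (auto intro: INF_lower2)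
  obtain U V W where UVW: "card U = 3" "card V = p" "graph G"
    "arcs_ends G = (U \<times> V) \<union> (V \<times> U) \<union> (U \<times> W) \<union> (W \<times> U) \<union> (V \<times> W) \<union> (W \<times> V)"
    using assms(4) unfolding complete_tripartite_digraph_def by blast
  then have "U \<noteq> {}" "V \<noteq> {}" using assms(1) by auto
  then obtain u v where "u \<rightarrow>\<^bsub>G\<^esub> v" using UVW(4) by blast
  then show "2 \<le> oriented_diameter G"
    unfolding oriented_diameter_def
    by (intro INF_greatest ddiameter_ge_2[OF UVW(3)]) (auto simp: strong_orientation_def)
qed

end
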